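(* Let $n\ge 2$ and $0\le m\le n$, and let $X=\{x_1,\dots,x_m\}$ be a sub-source of $m$ symbols of a source $A$ of $n$ symbols. Then the quantity $$\min_{C\in\Phi^{(n)}}\Big\{\min_{\{B\,\mid\, X\sqsubseteq B,\ |B|=n\}}\mathcal{R}_C(B)\Big\}$$ is a tight lower bound on the redundancy obtainable by a Huffman code for $A$ given $X$; that is, every source $A'$ with $X\sqsubseteq A'$ and $|A'|=n$ has $\mathcal{R}_H(A')$ at least this quantity, and there exists a source $B$ with $X\sqsubseteq B$ and $|B|=n$ for which $\mathcal{R}_H(B)$ equals this quantity.
   Context: All logarithms are base $2$. A (discrete memoryless) source $A$ of $n=|A|\ge 2$ symbols is an alphabet $\{a_1,\dots,a_n\}$ with probabilities $\mathrm{p}(a_i)>0$, $\sum_i \mathrm{p}(a_i)=1$. For a code $C$ assigning to $a_i$ a codeword of length $\mathrm{l}_C(a_i)$, the redundancy is $\mathcal{R}_C(A)=\sum_{i}\mathrm{p}(a_i)\,\mathrm{l}_C(a_i)+\sum_i \mathrm{p}(a_i)\log \mathrm{p}(a_i)$. A sub-source $X$ of $A$, written $X\sqsubseteq A$, is a (possibly empty) subset of the symbols of $A$ together with their associated probabilities (which need not sum to $1$); $|X|$ is its number of symbols. Sources $B$ (and $A'$) range over sources on a fixed alphabet of $n$ symbols containing the symbols of $X$, such that the symbols of $X$ have their given probabilities; the other probabilities are free (positive, with total sum $1$). Huffman algorithm: starting from the symbols of the source, repeatedly replace two symbols $a,b$ such that no other current symbol has smaller probability than either of them by a merged symbol $[a,b]$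 with $\mathrm{p}([a,b])=\mathrm{p}(a)+\mathrm{p}(b)$, until a single symbol remains. The resulting nested bracketing is a full binary tree whose leaves are the original symbols; it represents a binary prefix-free code $H$ (a Huffman code) in which the codeword length of a symbol is the depth of its leaf. $\mathcal{R}_H(B)$ denotes the redundancy of a Huffman code for $B$ (it does not depend on how ties are broken). $\Phi^{(n)}$ is the set of codes on the given $n$-symbol alphabet that the Huffman algorithm outputs for some choice of source probabilities on that alphabet. *)

theory Defs
  imports Complex_Main
begin

text \<open>A source is an alphabet \<open>S\<close> with a probability function; only the values on \<open>S\<close> matter.\<close>

definition source :: "'a set \<Rightarrow> ('a \<Rightarrow> real) \<Rightarrow> bool" where
  "source S p \<longleftrightarrow> finite S \<and> card S \<ge> 2 \<and> (\<forall>a\<in>S. p a > 0) \<and> (\<Sum>a\<in>S. p a) = 1"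

definition subsource :: "'a set \<Rightarrow> ('a \<Rightarrow> real) \<Rightarrow> 'a set \<Rightarrow> ('a \<Rightarrow> real) \<Rightarrow> bool" where
  "subsource X q S p \<longleftrightarrow> X \<subseteq> S \<and> (\<forall>x\<in>X. q x = p x)"

text \<open>The sources on the alphabet \<open>S\<close> that have the prescribed probabilities \<open>q\<close> on \<open>X\<close>.\<close>

definition extensions :: "'a set \<Rightarrow> 'a set \<Rightarrow> ('a \<Rightarrow> real) \<Rightarrow> ('a \<Rightarrow> real) set" where
  "extensions S X q = {p. source S p \<and> subsource X q S p}"

type_synonym 'a code = "'a \<Rightarrow> bool list"

definition redundancy :: "'a set \<Rightarrow> ('a \<Rightarrow> real) \<Rightarrow> 'a code \<Rightarrow> real" where
  "redundancy S p C = (\<Sum>a\<in>S. p a * real (length (C a))) + (\<Sum>a\<in>S. p a * log 2 (p a))"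

text \<open>Nested bracketings of symbols: \<open>Merge a b\<close> is the merged symbol \<open>[a, b]\<close>.\<close>

datatype 'a bracketing = Symbol 'a | Merge "'a bracketing" "'a bracketing"

primrec weight :: "('a \<Rightarrow> real) \<Rightarrow> 'a bracketing \<Rightarrow> real" where
  "weight p (Symbol x) = p x"
| "weight p (Merge a b) = weight p a + weight p b"

text \<open>
  The codeword of a symbol is the path from the root to its leaf, so its length is the depth of
  that leaf. In the bracketings produced below every symbol of the alphabet labels exactly
  one leaf. Values at symbols that are not in the tree are irrelevant.
\<close>

primrec codeword :: "'a bracketing \<Rightarrow> 'a code" where
  "codeword (Symbol x) = (\<lambda>s. [])"
| "codeword (Merge a b) =
    (\<lambda>s. if s \<in> set_bracketing a then False # codeword a s else True # codeword b s)"

text \<open>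
  The state of the Huffman algorithm is the set of current symbols. A set suffices because
  distinct current symbols always have disjoint leaf sets. The relation is nondeterministic, so
  all ways of breaking ties are included.
\<close>

inductive huffman_step ::
    "('a \<Rightarrow> real) \<Rightarrow> 'a bracketing set \<Rightarrow> 'a bracketing set \<Rightarrow> bool" for p where
  "\<lbrakk>a \<in> F; b \<in> F; a \<noteq> b;
    \<forall>c \<in> F - {a, b}. weight p a \<le> weight p c \<and> weight p b \<le> weight p c\<rbrakk>
   \<Longrightarrow> huffman_step p F (insert (Merge a b) (F - {a, b}))"

definition huffman_codes :: "'a set \<Rightarrow> ('a \<Rightarrow> real) \<Rightarrow> 'a code set" where
  "huffman_codes S p = {codeword T | T. (huffman_step p)\<^sup>*\<^sup>* (Symbol ` S) {T}}"

definition Phi :: "'a set \<Rightarrow> 'a code set" where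
  "Phi S = (\<Union>p\<in>{p. source S p}. huffman_codes S p)"

definition is_minimum :: "real set \<Rightarrow> real \<Rightarrow> bool" where
  "is_minimum R r \<longleftrightarrow> r \<in> R \<and> (\<forall>s\<in>R. r \<le> s)"

end

theory Submission
  imports Defs "HOL-Combinatorics.Transposition"
begin

text \<open>
  For a fixed code with lengths \<open>l\<close>, Gibbs' inequality shows that the redundancy is minimised by
  making the free probabilities proportional to \<open>2 powr - l\<close>. As \<open>\<Phi>\<close> is finite, some code
  \<open>C\<close> with its minimising source \<open>B\<close> attains the double minimum. A Huffman code for \<open>B\<close> is no worse
  than \<open>C\<close>, and it lies in \<open>\<Phi>\<close>, so it cannot be better than the double minimum either.

  Optimality of Huffman codes is shown against arbitrary lengths \<open>l\<close> satisfying Kraft's inequality,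
  by induction along a run of the algorithm. The two lightest symbols \<open>a\<close>, \<open>b\<close> may be assumed to
  have the two largest lengths \<open>l a \<ge> l b\<close>; since the other Kraft summands are multiples of
  \<open>2 powr - l b\<close>, the merged symbol can be given the length \<open>l b - 1\<close>.
\<close>

section \<open>Minimising the redundancy of a fixed code\<close>

text \<open>The tangent bound \<open>ln x \<le> x - 1\<close> at \<open>x = t / p\<close>. The
  right-hand side is linear in \<open>p - t\<close>, so it cancels when summed over two functions of
  equal total mass.\<close>

lemma log_ratio_ge:
  fixes p t :: real
  assumes "p > 0" "t > 0"
  shows "p * (log 2 p - log 2 t) \<ge> (p - t) / ln 2"
proof -
  have "ln (t / p) \<le> t / p - 1"
    using assms by (intro ln_le_minus_one) simp
  then have "p * (ln t - ln p) \<le> p * (t / p - 1)"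
    using assms by (intro mult_left_mono) (simp_all add: ln_div)
  then have "p - t \<le> p * (ln p - ln t)"
    using assms by (simp add: algebra_simps)
  then have "(p - t) / ln 2 \<le> p * (ln p - ln t) / ln 2"
    by (intro divide_right_mono) simp_all
  then show ?thesis
    by (simp add: log_def right_diff_distrib diff_divide_distrib)
qed

text \<open>Stated for equal total masses rather than total mass 1, because it is applied to the
  free symbols alone.\<close>

lemma gibbs_inequality:
  fixes p t :: "'a \<Rightarrow> real"
  assumes "\<And>a. a \<in> Y \<Longrightarrow> p a > 0" "\<And>a. a \<in> Y \<Longrightarrow> t a > 0" "sum p Y = sum t Y"
  shows "0 \<le> (\<Sum>a\<in>Y. p a * (log 2 (p a) - log 2 (t a)))"
proof -
  have "0 = (\<Sum>a\<in>Y. (p a - t a) / ln 2)"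
    using assms(3) by (simp add: sum_subtractf flip: sum_divide_distrib)
  also have "\<dots> \<le> (\<Sum>a\<in>Y. p a * (log 2 (p a) - log 2 (t a)))"
    using assms(1,2) by (intro sum_mono log_ratio_ge)
  finally show ?thesis .
qed

lemma redundancy_alt:
  "redundancy S p C = (\<Sum>a\<in>S. p a * (real (length (C a)) + log 2 (p a)))"
  by (simp add: redundancy_def algebra_simps sum.distrib)

text \<open>The minimiser \<open>t\<close> makes length plus log-probability constant on the free
  symbols \<open>Y\<close>. Hence the excess of any competitor \<open>p\<close> over
  \<open>t\<close> is exactly the relative entropy of \<open>p\<close> with respect to
  \<open>t\<close> on \<open>Y\<close>.\<close>

lemma redundancy_attains_min:
  assumes pA: "pA \<in> extensions S X q"
  shows "\<exists>r. is_minimum ((\<lambda>p. redundancy S p C) ` extensions S X q) r"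
proof -
  define Y where "Y = S - X"
  define g :: "'a \<Rightarrow> real" where "g a = (1/2) ^ length (C a)" for a
  \<comment> \<open>\<open>k\<close> scales the weights \<open>g\<close> to the mass that
    \<open>X\<close> leaves free. For empty \<open>Y\<close> it is \<open>0 / 0 = 0\<close>, but
    then \<open>t\<close> never uses it.\<close>
  define k where "k = sum pA Y / sum g Y"
  define t where "t a = (if a \<in> Y then k * g a else q a)" for a
  have ext: "finite S" "card S \<ge> 2" "X \<subseteq> S"
    and ext': "\<And>a. a \<in> S \<Longrightarrow> pA a > 0" "sum pA S = 1" "\<And>x. x \<in> X \<Longrightarrow> q x = pA x"
    using pA by (auto simp: extensions_def source_def subsource_def)
  have split: "sum f S = sum f X + sum f Y" for f :: "'a \<Rightarrow> real"
    unfolding Y_def using ext by (simp add: sum.subset_diff)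
  have g_pos: "g a > 0" for a
    by (simp add: g_def)
  have finY: "finite Y" and YS: "Y \<subseteq> S"
    using ext by (auto simp: Y_def)
  have k_pos: "k > 0" if "a \<in> Y" for a
  proof -
    have "sum pA Y > 0" "sum g Y > 0"
      using that finY YS ext'(1) g_pos by (auto intro!: sum_pos)
    then show ?thesis by (simp add: k_def)
  qed
  have t_pos: "t a > 0" if "a \<in> S" for a
    using that ext' k_pos[of a] g_pos[of a] by (auto simp: t_def Y_def)
  have sum_t: "sum t Y = sum pA Y"
  proof (cases "Y = {}")
    case False
    then have "sum g Y > 0"
      using finY g_pos by (intro sum_pos) auto
    then show ?thesis
      by (simp add: t_def k_def flip: sum_distrib_left sum_divide_distrib)
  qed simp
  have t_X: "t a = q a" if "a \<in> X" for a
    using that by (simp add: t_def Y_def)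
  have "sum t X = sum pA X"
    using ext' t_X by (intro sum.cong) auto
  then have "sum t S = 1"
    using sum_t ext'(2) split by simp
  then have t_ext: "t \<in> extensions S X q"
    using ext t_pos t_X by (auto simp: extensions_def source_def subsource_def)
  have log_t: "real (length (C a)) + log 2 (t a) = log 2 k" if "a \<in> Y" for a
    using that k_pos[OF that]
    by (simp add: t_def g_def log_mult log_nat_power log_divide)
  have "redundancy S t C \<le> redundancy S p C" if "p \<in> extensions S X q" for p
  proof -
    have p: "\<And>a. a \<in> S \<Longrightarrow> p a > 0" "sum p S = 1" "\<And>x. x \<in> X \<Longrightarrow> q x = p x"
      using that by (auto simp: extensions_def source_def subsource_def)
    have "sum p X = sum t X"
      using p t_X by (intro sum.cong) auto
    then have sum_p: "sum p Y = sum t Y"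
      using split[of p] split[of t] p(2) \<open>sum t S = 1\<close> by simp
    \<comment> \<open>The bracket is the constant \<open>log 2 k\<close>, so only the mass of
      \<open>Y\<close> matters, and \<open>p\<close> and \<open>t\<close> agree on that.\<close>
    have "(\<Sum>a\<in>Y. t a * (real (length (C a)) + log 2 (t a))) = (\<Sum>a\<in>Y. p a * log 2 k)"
      using sum_p log_t by (simp flip: sum_distrib_right)
    also have "\<dots> \<le> (\<Sum>a\<in>Y. p a * log 2 k) + (\<Sum>a\<in>Y. p a * (log 2 (p a) - log 2 (t a)))"
      using gibbs_inequality[of Y p t] sum_p p(1) t_pos YS by auto
    also have "\<dots> = (\<Sum>a\<in>Y. p a * (real (length (C a)) + log 2 (p a)))"
      unfolding sum.distrib[symmetric]
      by (intro sum.cong refl) (simp add: log_t[symmetric] algebra_simps)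
    finally show ?thesis
      using p(3) t_X unfolding redundancy_alt split by simp
  qed
  with t_ext show ?thesis
    unfolding is_minimum_def by blast
qed

section \<open>Runs of the Huffman algorithm\<close>

lemma card_huffman_step:
  assumes "huffman_step p F G" "finite F"
  shows "finite G \<and> card G < card F"
  using assms
proof cases
  case (1 a b)
  \<comment> \<open>Only an upper bound, since in an arbitrary \<open>F\<close> the merged symbol
    might already be present.\<close>
  have "card (insert (Merge a b) (F - {a, b})) \<le> Suc (card (F - {a, b}))"
    by (simp add: card_insert_if assms(2))
  also have "\<dots> < card F"
    using 1 assms(2) card_Suc_Diff1[of F a] card_Suc_Diff1[of "F - {a}" b]
    by (auto simp: Diff_insert2[symmetric] insert_commute)
  finally show ?thesis using 1 assms(2) by simp
qed

text \<open>Here \<open>p\<close> may change from step to step. This over-approximates the runs for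
  all sources at once, and each state still has only finitely many successors, all of smaller
  cardinality.\<close>

lemma finite_reachable:
  assumes "finite F"
  shows "finite {G. (\<lambda>F G. \<exists>p. huffman_step p F G)\<^sup>*\<^sup>* F G}"
  using assms
proof (induction "card F" arbitrary: F rule: less_induct)
  case less
  let ?R = "\<lambda>F G. \<exists>p. huffman_step p F G"
  have "{G. ?R F G} \<subseteq> (\<lambda>(a, b). insert (Merge a b) (F - {a, b})) ` (F \<times> F)"
    by (auto elim!: huffman_step.cases)
  then have "finite {G. ?R F G}"
    using less.prems by (meson finite_SigmaI finite_imageI finite_subset)
  moreover have "finite {G. ?R\<^sup>*\<^sup>* G' G}" if "?R F G'" for G'
    using that card_huffman_step less by blast
  ultimately have "finite (insert F (\<Union>G' \<in> {G. ?R F G}. {G. ?R\<^sup>*\<^sup>* G' G}))"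
    by simp
  moreover have "{G. ?R\<^sup>*\<^sup>* F G} \<subseteq> insert F (\<Union>G' \<in> {G. ?R F G}. {G. ?R\<^sup>*\<^sup>* G' G})"
    by (blast elim: converse_rtranclpE)
  ultimately show ?case
    by (rule finite_subset[rotated])
qed

lemma finite_Phi:
  assumes "finite S"
  shows "finite (Phi S)"
proof -
  let ?R = "\<lambda>F G. \<exists>p. huffman_step p F G"
  have "(huffman_step p)\<^sup>*\<^sup>* F G \<Longrightarrow> ?R\<^sup>*\<^sup>* F G" for p and F G :: "'a bracketing set"
    by (erule mono_rtranclp[rule_format, rotated]) blast
  then have "Phi S \<subseteq> (codeword \<circ> the_elem) ` {G. ?R\<^sup>*\<^sup>* (Symbol ` S) G}"
    by (fastforce simp: Phi_def huffman_codes_def image_iff)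
  then show ?thesis
    using finite_reachable[of "Symbol ` S"] assms finite_subset by blast
qed

lemma huffman_terminates:
  assumes "finite F" "F \<noteq> {}"
  shows "\<exists>T. (huffman_step p)\<^sup>*\<^sup>* F {T}"
  using assms
proof (induction "card F" arbitrary: F rule: less_induct)
  case less
  define a where "a = arg_min_on (weight p) F"
  have a: "a \<in> F" "\<And>c. c \<in> F \<Longrightarrow> weight p a \<le> weight p c"
    using less.prems by (simp_all add: a_def arg_min_if_finite arg_min_least)
  show ?case
  proof (cases "F = {a}")
    case False
    define b where "b = arg_min_on (weight p) (F - {a})"
    have ne: "F - {a} \<noteq> {}" "finite (F - {a})"
      using False a less.prems by auto
    have b: "b \<in> F - {a}" "\<And>c. c \<in> F - {a} \<Longrightarrow> weight p b \<le> weight p c"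
      unfolding b_def using ne by (metis arg_min_if_finite(1)) (metis ne arg_min_least)
    let ?G = "insert (Merge a b) (F - {a, b})"
    have step: "huffman_step p F ?G"
      using a b by (intro huffman_step.intros) auto
    then obtain T where "(huffman_step p)\<^sup>*\<^sup>* ?G {T}"
      using less card_huffman_step by (metis insert_not_empty)
    with step show ?thesis
      by (meson converse_rtranclp_into_rtranclp)
  qed auto
qed

lemma huffman_codes_nonempty:
  assumes "source S p"
  shows "huffman_codes S p \<noteq> {}"
proof -
  have "finite S" "S \<noteq> {}"
    using assms by (auto simp: source_def)
  then show ?thesis
    using huffman_terminates[of "Symbol ` S" p] by (auto simp: huffman_codes_def)
qed

section \<open>Leaf-disjointness as an invariant of runs\<close>

primrec leaf_disjoint :: "'a bracketing \<Rightarrow> bool" where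
  "leaf_disjoint (Symbol x) = True"
| "leaf_disjoint (Merge a b) \<longleftrightarrow>
    leaf_disjoint a \<and> leaf_disjoint b \<and> set_bracketing a \<inter> set_bracketing b = {}"

definition forest_on :: "'a set \<Rightarrow> 'a bracketing set \<Rightarrow> bool" where
  "forest_on S F \<longleftrightarrow> finite F \<and> (\<forall>a\<in>F. leaf_disjoint a) \<and>
    pairwise (\<lambda>a b. set_bracketing a \<inter> set_bracketing b = {}) F \<and>
    (\<Union>a\<in>F. set_bracketing a) = S"

lemma set_bracketing_nonempty: "set_bracketing T \<noteq> {}"
  by (induction T) auto

lemma finite_set_bracketing: "finite (set_bracketing T)"
  by (induction T) auto

lemma forest_on_Symbols: "finite S \<Longrightarrow> forest_on S (Symbol ` S)"
  by (auto simp: forest_on_def pairwise_def)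

lemma forest_on_merge:
  assumes "forest_on S F" "a \<in> F" "b \<in> F" "a \<noteq> b"
  shows "forest_on S (insert (Merge a b) (F - {a, b}))"
  using assms unfolding forest_on_def pairwise_def by auto

lemma forest_on_huffman_step:
  "huffman_step p F G \<Longrightarrow> forest_on S F \<Longrightarrow> forest_on S G"
  by (auto elim!: huffman_step.cases intro!: forest_on_merge)

lemma forest_on_huffman_steps:
  "(huffman_step p)\<^sup>*\<^sup>* F G \<Longrightarrow> forest_on S F \<Longrightarrow> forest_on S G"
  by (induction rule: rtranclp_induct) (auto intro: forest_on_huffman_step)

text \<open>Ensures that inserting the merged symbol into the state, which is a set, adds a
  genuinely new summand to sums over it. A second tree containing the leaves of \<open>a\<close>
  would violate disjointness.\<close>

lemma Merge_notin_forest: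
  assumes "forest_on S F" "a \<in> F" "b \<in> F" "a \<noteq> b"
  shows "Merge a b \<notin> F - {a, b}"
proof
  assume "Merge a b \<in> F - {a, b}"
  moreover have "Merge a b \<noteq> a"
  proof
    assume "Merge a b = a"
    then have "size (Merge a b) = size a" by (simp only:)
    then show False by simp
  qed
  ultimately have "set_bracketing (Merge a b) \<inter> set_bracketing a = {}"
    using assms unfolding forest_on_def pairwise_def by blast
  then show False
    using set_bracketing_nonempty[of a] by auto
qed

lemma huffman_codesE:
  assumes "H \<in> huffman_codes S p" "finite S"
  obtains T where "H = codeword T" "(huffman_step p)\<^sup>*\<^sup>* (Symbol ` S) {T}"
    "leaf_disjoint T" "set_bracketing T = S"
proof -
  obtain T where T: "H = codeword T" "(huffman_step p)\<^sup>*\<^sup>* (Symbol ` S) {T}"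
    using assms(1) by (auto simp: huffman_codes_def)
  have "forest_on S {T}"
    using forest_on_huffman_steps[OF T(2) forest_on_Symbols[OF assms(2)]] .
  then show thesis
    using T that by (simp add: forest_on_def)
qed

section \<open>Code lengths\<close>

text \<open>The total weight of the internal nodes. It equals the expected codeword length, but
  grows by one summand per merge, which suits induction along a run.\<close>

primrec merge_cost :: "('a \<Rightarrow> real) \<Rightarrow> 'a bracketing \<Rightarrow> real" where
  "merge_cost p (Symbol x) = 0"
| "merge_cost p (Merge a b) = merge_cost p a + merge_cost p b + (weight p a + weight p b)"

text \<open>With \<open>f\<close> depending on symbol and depth, one recursion serves both the
  expected length and the Kraft sum.\<close>

lemma sum_leaves_Merge:
  assumes "leaf_disjoint (Merge a b)"
  shows "(\<Sum>s\<in>set_bracketing (Merge a b). f s (length (codeword (Merge a b) s))) =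
    (\<Sum>s\<in>set_bracketing a. f s (Suc (length (codeword a s)))) +
    (\<Sum>s\<in>set_bracketing b. f s (Suc (length (codeword b s))))"
proof -
  have "s \<notin> set_bracketing a" if "s \<in> set_bracketing b" for s
    using assms that by auto
  then show ?thesis
    using assms by (simp add: sum.union_disjoint finite_set_bracketing)
qed

lemma weight_eq_sum: "leaf_disjoint T \<Longrightarrow> weight p T = sum p (set_bracketing T)"
  by (induction T) (auto simp: sum.union_disjoint finite_set_bracketing)

lemma merge_cost_eq_sum:
  "leaf_disjoint T \<Longrightarrow>
    merge_cost p T = (\<Sum>s\<in>set_bracketing T. p s * real (length (codeword T s)))"
proof (induction T)
  case (Merge a b)
  then show ?case
    unfolding sum_leaves_Merge[OF Merge.prems, where f = "\<lambda>s k. p s * real k"]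
    by (simp add: distrib_left sum.distrib weight_eq_sum)
qed simp

lemma kraft_equality:
  "leaf_disjoint T \<Longrightarrow> (\<Sum>s\<in>set_bracketing T. (1/2::real) ^ length (codeword T s)) = 1"
proof (induction T)
  case (Merge a b)
  then show ?case
    unfolding sum_leaves_Merge[OF Merge.prems, where f = "\<lambda>s k. (1/2) ^ k"]
    by (simp flip: sum_divide_distrib)
qed simp

section \<open>Optimality of Huffman codes\<close>

lemma sum_remove2:
  assumes "finite F" "a \<in> F" "b \<in> F" "a \<noteq> b"
  shows "sum f F = f a + (f b + sum f (F - {a, b}))"
proof -
  have "sum f (F - {a}) = f b + sum f (F - {a} - {b})"
    using assms by (intro sum.remove) auto
  moreover have "F - {a} - {b} = F - {a, b}"
    by auto
  ultimately show ?thesis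
    using assms by (simp add: sum.remove[of F a])
qed

lemma sum_swap:
  fixes f :: "'b \<Rightarrow> 'c \<Rightarrow> 'd::comm_monoid_add"
  assumes "finite F" "a \<in> F" "x \<in> F" "a \<noteq> x"
  shows "(\<Sum>c\<in>F. f c (l (transpose a x c))) =
    f a (l x) + (f x (l a) + (\<Sum>c\<in>F - {a, x}. f c (l c)))"
proof -
  have "(\<Sum>c\<in>F - {a, x}. f c (l (transpose a x c))) = (\<Sum>c\<in>F - {a, x}. f c (l c))"
    by (intro sum.cong) auto
  then show ?thesis
    using assms by (simp add: sum_remove2[of F a x])
qed

text \<open>The exchange argument: swapping lowers the cost by
  \<open>(w x - w a) * (l x - l a) \<ge> 0\<close> and only permutes the Kraft summands.\<close>

lemma swap_lengths:
  fixes w :: "'b \<Rightarrow> real" and l :: "'b \<Rightarrow> nat"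
  assumes "finite F" "a \<in> F" "x \<in> F" "w a \<le> w x" "l a \<le> l x"
  shows "(\<Sum>c\<in>F. w c * real (l (transpose a x c))) \<le> (\<Sum>c\<in>F. w c * real (l c))"
    and "(\<Sum>c\<in>F. (1/2::real) ^ l (transpose a x c)) = (\<Sum>c\<in>F. (1/2) ^ l c)"
proof -
  show "(\<Sum>c\<in>F. w c * real (l (transpose a x c))) \<le> (\<Sum>c\<in>F. w c * real (l c))"
  proof (cases "a = x")
    case False
    have "(\<Sum>c\<in>F. w c * real (l c)) =
        w a * real (l a) + (w x * real (l x) + (\<Sum>c\<in>F - {a, x}. w c * real (l c)))"
      using assms False by (intro sum_remove2)
    moreover have "0 \<le> (w x - w a) * (real (l x) - real (l a))"
      using assms by simp
    ultimately show ?thesis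
      unfolding sum_swap[OF assms(1-3) False, where f = "\<lambda>c k. w c * real k"]
      by (simp add: algebra_simps)
  qed simp
  show "(\<Sum>c\<in>F. (1/2::real) ^ l (transpose a x c)) = (\<Sum>c\<in>F. (1/2) ^ l c)"
    using assms by (intro sum.reindex_bij_betw[of _ F F "\<lambda>c. (1/2) ^ l c"]) simp
qed

text \<open>Two exchanges suffice: \<open>a\<close> takes a largest length, then \<open>b\<close>
  takes a largest length among the remaining elements. The second swap avoids \<open>a\<close> and
  so keeps the first gain.\<close>

lemma lightest_are_deepest:
  fixes w :: "'b \<Rightarrow> real" and l :: "'b \<Rightarrow> nat"
  assumes "finite F" "a \<in> F" "b \<in> F" "a \<noteq> b" "w a \<le> w b"
    and "\<And>c. c \<in> F - {a, b} \<Longrightarrow> w b \<le> w c"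
  shows "\<exists>l' :: 'b \<Rightarrow> nat.
    (\<Sum>c\<in>F. w c * real (l' c)) \<le> (\<Sum>c\<in>F. w c * real (l c)) \<and>
    (\<Sum>c\<in>F. (1/2::real) ^ l' c) = (\<Sum>c\<in>F. (1/2) ^ l c) \<and>
    l' b \<le> l' a \<and> (\<forall>c\<in>F - {a, b}. l' c \<le> l' b)"
proof -
  have ex_max: "\<exists>x\<in>A. \<forall>c\<in>A. k c \<le> k x" if "finite A" "A \<noteq> {}" for A and k :: "'b \<Rightarrow> nat"
    using obtains_MAX[OF that, of k] by (metis Max_ge finite_imageI imageI that(1))
  obtain x where x: "x \<in> F" "\<And>c. c \<in> F \<Longrightarrow> l c \<le> l x"
    using ex_max[of F l] assms by blast
  define l1 where "l1 c = l (transpose a x c)" for c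
  have l1_a: "l1 c \<le> l1 a" if "c \<in> F" for c
    using x that assms(2) by (auto simp: l1_def transpose_def)
  obtain y where y: "y \<in> F - {a}" "\<And>c. c \<in> F - {a} \<Longrightarrow> l1 c \<le> l1 y"
    using ex_max[of "F - {a}" l1] assms by blast
  define l2 where "l2 c = l1 (transpose b y c)" for c
  have wx: "w a \<le> w x" and wy: "w b \<le> w y"
    using x(1) y(1) assms(5) assms(6)[of x] assms(6)[of y] by fastforce+
  have "y \<in> F" "l1 b \<le> l1 y"
    using y assms(3,4) by auto
  note swap1 = swap_lengths[OF assms(1,2) x(1) wx x(2)[OF assms(2)], folded l1_def]
    and swap2 = swap_lengths[OF assms(1,3) this(1) wy this(2), folded l2_def]
  show ?thesis
  proof (intro exI conjI ballI)
    show "(\<Sum>c\<in>F. w c * real (l2 c)) \<le> (\<Sum>c\<in>F. w c * real (l c))"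
      using swap2(1) swap1(1) by (rule order.trans)
    show "(\<Sum>c\<in>F. (1/2::real) ^ l2 c) = (\<Sum>c\<in>F. (1/2) ^ l c)"
      using swap2(2) swap1(2) by (rule trans)
    show "l2 b \<le> l2 a"
      using l1_a y(1) assms(4) by (auto simp: l2_def transpose_def)
    show "l2 c \<le> l2 b" if "c \<in> F - {a, b}" for c
      using y that assms(3,4) by (auto simp: l2_def transpose_def)
  qed
qed

text \<open>Over the common denominator \<open>2 ^ k\<close> the sum has an integer numerator
  \<open>N\<close>. The slack \<open>\<epsilon>\<close> gives \<open>N + 1 < 2 ^ k\<close>, hence
  \<open>N + 2 \<le> 2 ^ k\<close>, which is room for doubling the summand
  \<open>(1/2) ^ k\<close>.\<close>

lemma kraft_integrality:
  fixes l :: "'b \<Rightarrow> nat"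
  assumes "\<And>c. c \<in> A \<Longrightarrow> l c \<le> k"
    and "(\<Sum>c\<in>A. (1/2::real) ^ l c) + (1/2) ^ k + \<epsilon> \<le> 1" "\<epsilon> > 0"
  shows "k > 0" "(\<Sum>c\<in>A. (1/2::real) ^ l c) + (1/2) ^ (k - 1) \<le> 1"
proof -
  define N where "N = (\<Sum>c\<in>A. 2 ^ (k - l c) :: nat)"
  have N: "(\<Sum>c\<in>A. (1/2::real) ^ l c) = real N * (1/2) ^ k"
    unfolding N_def of_nat_sum sum_distrib_right using assms(1)
    by (intro sum.cong) (simp_all add: power_divide field_simps flip: power_add)
  have "(real N + 1) * (1/2) ^ k < 1"
    using assms(2,3) unfolding N by (simp add: algebra_simps)
  then have "real N + 1 < 2 ^ k"
    by (simp add: power_divide divide_simps)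
  then have "real (N + 1) < real (2 ^ k)"
    by simp
  then have lt: "N + 1 < 2 ^ k"
    unfolding of_nat_less_iff .
  then show "k > 0"
    by (cases k) auto
  from lt have "real (N + 2) \<le> real (2 ^ k)"
    unfolding of_nat_le_iff by simp
  then have "(real N + 2) * (1/2) ^ k \<le> 1"
    by (simp add: power_divide divide_simps)
  then show "(\<Sum>c\<in>A. (1/2::real) ^ l c) + (1/2) ^ (k - 1) \<le> 1"
    using \<open>k > 0\<close> unfolding N by (cases k) (simp_all add: algebra_simps)
qed

text \<open>\<open>k\<close> is the length for the merged symbol; its two parts lie one level
  deeper, whence the factor \<open>real k + 1\<close>.\<close>

lemma merge_lengths:
  fixes w :: "'b \<Rightarrow> real" and l :: "'b \<Rightarrow> nat"
  assumes ab: "finite F" "a \<in> F" "b \<in> F" "a \<noteq> b"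
    and w: "0 \<le> w a" "w a \<le> w b" "\<And>c. c \<in> F - {a, b} \<Longrightarrow> w b \<le> w c"
    and kraft: "(\<Sum>c\<in>F. (1/2::real) ^ l c) \<le> 1"
  shows "\<exists>l' k. (\<Sum>c\<in>F - {a, b}. (1/2::real) ^ l' c) + (1/2) ^ k \<le> 1 \<and>
    (\<Sum>c\<in>F - {a, b}. w c * real (l' c)) + (w a + w b) * (real k + 1) \<le> (\<Sum>c\<in>F. w c * real (l c))"
proof -
  have split: "sum f F = f a + (f b + sum f (F - {a, b}))" for f :: "'b \<Rightarrow> real"
    using ab by (rule sum_remove2)
  obtain l' :: "'b \<Rightarrow> nat" where l':
    "(\<Sum>c\<in>F. w c * real (l' c)) \<le> (\<Sum>c\<in>F. w c * real (l c))"
    "(\<Sum>c\<in>F. (1/2::real) ^ l' c) = (\<Sum>c\<in>F. (1/2) ^ l c)"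
    "l' b \<le> l' a" "\<And>c. c \<in> F - {a, b} \<Longrightarrow> l' c \<le> l' b"
    using lightest_are_deepest[OF ab w(2,3), where l = l] by blast
  \<comment> \<open>The summand of \<open>a\<close> plays the part of the positive slack
    \<open>\<epsilon>\<close>.\<close>
  have "(\<Sum>c\<in>F - {a, b}. (1/2::real) ^ l' c) + (1/2) ^ l' b + (1/2) ^ l' a \<le> 1"
    using l'(2) kraft split[of "\<lambda>c. (1/2) ^ l' c"] by simp
  from kraft_integrality[OF l'(4) this]
  have k: "l' b > 0" "(\<Sum>c\<in>F - {a, b}. (1/2::real) ^ l' c) + (1/2) ^ (l' b - 1) \<le> 1"
    by simp_all
  \<comment> \<open>The length of \<open>a\<close> is shortened to that of \<open>b\<close>, so both
    become children of a node at depth \<open>l' b - 1\<close>.\<close>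
  have "w a * real (l' b) \<le> w a * real (l' a)"
    using w(1) l'(3) by (intro mult_left_mono) auto
  then have "(\<Sum>c\<in>F - {a, b}. w c * real (l' c)) + (w a + w b) * (real (l' b - 1) + 1)
      \<le> (\<Sum>c\<in>F. w c * real (l c))"
    using l'(1) k(1) split[of "\<lambda>c. w c * real (l' c)"] by (simp add: of_nat_diff algebra_simps)
  with k(2) show ?thesis
    by blast
qed

lemma weight_nonneg: "(\<And>s. s \<in> set_bracketing T \<Longrightarrow> p s \<ge> 0) \<Longrightarrow> weight p T \<ge> 0"
  by (induction T) auto

text \<open>The right-hand side is the cost of hanging the trees of the current forest at depths
  \<open>l\<close>. Generalising from single symbols to arbitrary states lets the induction follow
  the run.\<close>

lemma merge_cost_le_kraft:
  fixes l :: "'a bracketing \<Rightarrow> nat"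
  assumes "(huffman_step p)\<^sup>*\<^sup>* F {T}" "forest_on S F" "\<And>s. s \<in> S \<Longrightarrow> p s \<ge> 0"
    and "(\<Sum>c\<in>F. (1/2::real) ^ l c) \<le> 1"
  shows "merge_cost p T \<le> (\<Sum>c\<in>F. weight p c * real (l c)) + (\<Sum>c\<in>F. merge_cost p c)"
  using assms(1,2,4)
proof (induction arbitrary: l rule: converse_rtranclp_induct)
  case base
  have "weight p T \<ge> 0"
    using base assms(3) by (intro weight_nonneg) (auto simp: forest_on_def)
  then show ?case by simp
next
  case (step F G)
  from step.hyps(1) show ?case
  proof cases
    case (1 a b)
    have w: "weight p c \<ge> 0" if "c \<in> F" for c
      using step.prems assms(3) that by (intro weight_nonneg) (auto simp: forest_on_def)
    have fin: "finite F"
      using step.prems by (simp add: forest_on_def)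
    have split: "sum f F = f a + (f b + sum f (F - {a, b}))" for f :: "'a bracketing \<Rightarrow> real"
      using 1 fin by (intro sum_remove2)
    obtain l' :: "'a bracketing \<Rightarrow> nat" and k where l':
      "(\<Sum>c\<in>F - {a, b}. (1/2::real) ^ l' c) + (1/2) ^ k \<le> 1"
      "(\<Sum>c\<in>F - {a, b}. weight p c * real (l' c)) + (weight p a + weight p b) * (real k + 1)
        \<le> (\<Sum>c\<in>F. weight p c * real (l c))"
    \<comment> \<open>A step does not order its two symbols, whereas \<open>merge_lengths\<close>
      expects the lighter one first.\<close>
    proof (cases "weight p a \<le> weight p b")
      case True
      then show thesis
        using merge_lengths[of F a b "weight p" l] 1 fin w step.prems(2) that by auto
    next
      case False
      then show thesis
        using merge_lengths[of F b a "weight p" l] 1 fin w step.prems(2) that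
        by (auto simp: insert_commute add.commute)
    qed
    define l'' where "l'' = l'(Merge a b := k)"
    have notin: "Merge a b \<notin> F - {a, b}"
      using Merge_notin_forest[OF step.prems(1)] 1 by blast
    have sum_G: "(\<Sum>c\<in>G. f c (l'' c)) = f (Merge a b) k + (\<Sum>c\<in>F - {a, b}. f c (l' c))"
      for f :: "'a bracketing \<Rightarrow> nat \<Rightarrow> real"
    proof -
      have "(\<Sum>c\<in>F - {a, b}. f c (l'' c)) = (\<Sum>c\<in>F - {a, b}. f c (l' c))"
        using notin by (intro sum.cong) (auto simp: l''_def)
      then show ?thesis
        using 1 fin notin by (simp add: l''_def)
    qed
    have "forest_on S G"
      using step forest_on_huffman_step by blast
    moreover have "(\<Sum>c\<in>G. (1/2::real) ^ l'' c) \<le> 1"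
      using l'(1) by (simp add: sum_G[where f = "\<lambda>c j. (1/2) ^ j"])
    ultimately have "merge_cost p T
        \<le> (\<Sum>c\<in>G. weight p c * real (l'' c)) + (\<Sum>c\<in>G. merge_cost p c)"
      by (rule step.IH)
    \<comment> \<open>The extra 1 in \<open>real k + 1\<close> pays for the weight that
      \<open>merge_cost\<close> gains at the new node \<open>Merge a b\<close>.\<close>
    then show ?thesis
      using l'(2) split[of "merge_cost p"] sum_G[where f = "\<lambda>c j. merge_cost p c"]
      unfolding sum_G[where f = "\<lambda>c j. weight p c * real j"]
      by (simp add: algebra_simps)
  qed
qed

text \<open>The lengths of \<open>C\<close> come from a full binary tree and so satisfy Kraft with
  equality. The entropy term is common to both redundancies.\<close>

lemma huffman_optimal:
  assumes "source S p" "H \<in> huffman_codes S p" "C \<in> Phi S"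
  shows "redundancy S p H \<le> redundancy S p C"
proof -
  have fin: "finite S"
    using assms(1) by (simp add: source_def)
  obtain T where T: "H = codeword T" "(huffman_step p)\<^sup>*\<^sup>* (Symbol ` S) {T}"
    "leaf_disjoint T" "set_bracketing T = S"
    using huffman_codesE[OF assms(2) fin] .
  from assms(3) obtain p' where "C \<in> huffman_codes S p'"
    by (auto simp: Phi_def)
  then obtain U where U: "C = codeword U" "leaf_disjoint U" "set_bracketing U = S"
    using fin by (elim huffman_codesE)
  \<comment> \<open>Transfers lengths from symbols to one-leaf trees: the leaf set of
    \<open>Symbol s\<close> is \<open>{s}\<close>, and \<open>the_elem\<close> recovers
    \<open>s\<close>.\<close>
  define l where "l c = length (C (the_elem (set_bracketing c)))" for c
  have reindex: "(\<Sum>c\<in>Symbol ` S. f c) = (\<Sum>s\<in>S. f (Symbol s))" for f :: "'a bracketing \<Rightarrow> real"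
    by (simp add: sum.reindex inj_on_def)
  have "merge_cost p T
      \<le> (\<Sum>c\<in>Symbol ` S. weight p c * real (l c)) + (\<Sum>c\<in>Symbol ` S. merge_cost p c)"
  proof (rule merge_cost_le_kraft[OF T(2) forest_on_Symbols[OF fin]])
    show "p s \<ge> 0" if "s \<in> S" for s
      using assms(1) that by (auto simp: source_def intro: less_imp_le)
    show "(\<Sum>c\<in>Symbol ` S. (1/2::real) ^ l c) \<le> 1"
      using kraft_equality[OF U(2)] U by (simp add: reindex l_def)
  qed
  then show ?thesis
    using T merge_cost_eq_sum[OF T(3), of p] by (simp add: reindex l_def redundancy_def)
qed

theorem corollary1:
  fixes S X :: "'a set" and pA q :: "'a \<Rightarrow> real" and n m :: nat
  assumes "n \<ge> 2" and "m \<le> n"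
    and "source S pA" and "card S = n"
    and "subsource X q S pA" and "card X = m"
  shows "\<exists>\<mu> r.
      (\<forall>C\<in>Phi S. is_minimum ((\<lambda>p. redundancy S p C) ` extensions S X q) (\<mu> C)) \<and>
      is_minimum (\<mu> ` Phi S) r \<and>
      (\<forall>pA'\<in>extensions S X q. \<forall>H\<in>huffman_codes S pA'. r \<le> redundancy S pA' H) \<and>
      (\<exists>pB\<in>extensions S X q. redundancy S pB ` huffman_codes S pB = {r})"
proof -
  have "pA \<in> extensions S X q"
    using assms by (simp add: extensions_def)
  then have "\<forall>C. \<exists>r. is_minimum ((\<lambda>p. redundancy S p C) ` extensions S X q) r"
    by (intro allI redundancy_attains_min)
  from choice[OF this] obtain \<mu> where \<mu>:
    "\<And>C. is_minimum ((\<lambda>p. redundancy S p C) ` extensions S X q) (\<mu> C)"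
    by blast
  define r where "r = Min (\<mu> ` Phi S)"
  have "finite (Phi S)"
    using assms(3) by (intro finite_Phi) (simp add: source_def)
  moreover have "Phi S \<noteq> {}"
    using huffman_codes_nonempty[OF assms(3)] assms(3) by (auto simp: Phi_def)
  ultimately have r: "is_minimum (\<mu> ` Phi S) r"
    by (simp add: r_def is_minimum_def)
  have huffman_Phi: "H \<in> Phi S" if "p \<in> extensions S X q" "H \<in> huffman_codes S p" for p H
    using that by (auto simp: extensions_def Phi_def)
  \<comment> \<open>\<open>H\<close> is itself a member of \<open>Phi S\<close>, so
    \<open>r \<le> \<mu> H\<close>, and \<open>\<mu> H\<close> bounds the redundancy of
    \<open>H\<close> at \<open>p\<close> from below.\<close>
  have lower: "r \<le> redundancy S p H"
    if "p \<in> extensions S X q" "H \<in> huffman_codes S p" for p H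
    using r \<mu>[of H] that huffman_Phi[OF that] by (fastforce simp: is_minimum_def)
  obtain C where C: "C \<in> Phi S" "\<mu> C = r"
    using r by (auto simp: is_minimum_def)
  obtain pB where pB: "pB \<in> extensions S X q" "redundancy S pB C = r"
    using \<mu>[of C] C(2) by (auto simp: is_minimum_def)
  have src: "source S pB"
    using pB(1) by (simp add: extensions_def)
  \<comment> \<open>Squeezed between the lower bound \<open>r\<close> and the redundancy of
    \<open>C\<close> at \<open>pB\<close>, which is \<open>r\<close>.\<close>
  have "redundancy S pB H = r" if "H \<in> huffman_codes S pB" for H
    using lower[OF pB(1) that] huffman_optimal[OF src that C(1)] pB(2) by simp
  then have "redundancy S pB ` huffman_codes S pB = {r}"
    using huffman_codes_nonempty[OF src] by auto
  with \<mu> r lower pB(1) show ?thesis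
    by blast
qed

end
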